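(* Let $G$ be a finitely presented group such that for every $\phi\in\mathrm{Aut}(G)$ the group $G\rtimes_\phi\mathbb{Z}$ is conjugacy separable. Then $G$ is twisted conjugacy separable and Brinkmann conjugacy separable.
   Context: Maps are written on the right. The profinite topology on a group has as basis the cosets of finite index subgroups; a subset is separable if it is closed in this topology. If $G=\langle A\mid R\rangle$ and $\phi\in\mathrm{Aut}(G)$, then $G\rtimes_\phi\mathbb{Z}=\langle A,t\mid R,\ t^{-1}at=a\phi\ (a\in A)\rangle$. A group $G$ is: conjugacy separable if every conjugacy class in $G$ is separable; twisted conjugacy separable if for every $\phi\in\mathrm{Aut}(G)$ and $x\in G$ the set $\{(z^{-1}\phi)xz\mid z\in G\}$ is separable; Brinkmann conjugacy separable if for every $\phi\in\mathrm{Aut}(G)$ and $x\in G$ the set $\{z^{-1}(x\phi^k)z\mid z\in G,\ k\in\mathbb{Z}\}$ is separable. *)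

theory Defs
  imports "HOL-Algebra.Bij" "HOL-Algebra.Coset" "HOL-Analysis.Abstract_Topology"
begin

section \<open>Group presentations\<close>

text \<open>The letter \<open>(a, True)\<close> stands for the generator \<open>a\<close>, and \<open>(a, False)\<close> for its formal inverse.\<close>

type_synonym 'a word = "('a \<times> bool) list"

definition words_over :: "'a set \<Rightarrow> 'a word set" where
  "words_over A = lists (A \<times> UNIV)"

text \<open>
  A set of relations \<open>R\<close> consists of pairs \<open>(u, v)\<close>, read as \<open>u = v\<close>; a relator \<open>r\<close> is the pair
  \<open>(r, [])\<close>. The congruence on words generated by \<open>R\<close> and free cancellation has the elements of
  the group with presentation \<open>\<langle>A | R\<rangle>\<close> as its classes.
\<close>

inductive_set word_cong :: "'a set \<Rightarrow> ('a word \<times> 'a word) set \<Rightarrow> ('a word \<times> 'a word) set"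
  for A :: "'a set" and R :: "('a word \<times> 'a word) set" where
  refl: "u \<in> words_over A \<Longrightarrow> (u, u) \<in> word_cong A R"
| sym: "(u, v) \<in> word_cong A R \<Longrightarrow> (v, u) \<in> word_cong A R"
| trans: "(u, v) \<in> word_cong A R \<Longrightarrow> (v, w) \<in> word_cong A R \<Longrightarrow> (u, w) \<in> word_cong A R"
| append: "(u, v) \<in> word_cong A R \<Longrightarrow> (u', v') \<in> word_cong A R \<Longrightarrow>
    (u @ u', v @ v') \<in> word_cong A R"
| cancel: "a \<in> A \<Longrightarrow> ([(a, b), (a, \<not> b)], []) \<in> word_cong A R"
| relation: "(u, v) \<in> R \<Longrightarrow> u \<in> words_over A \<Longrightarrow> v \<in> words_over A \<Longrightarrow> (u, v) \<in> word_cong A R"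

definition word_class :: "'a set \<Rightarrow> ('a word \<times> 'a word) set \<Rightarrow> 'a word \<Rightarrow> 'a word set" where
  "word_class A R w = word_cong A R `` {w}"

definition presented_group :: "'a set \<Rightarrow> ('a word \<times> 'a word) set \<Rightarrow> 'a word set monoid" where
  "presented_group A R =
    \<lparr>carrier = words_over A // word_cong A R,
     mult = (\<lambda>X Y. \<Union>u\<in>X. \<Union>v\<in>Y. word_class A R (u @ v)),
     one = word_class A R []\<rparr>"

text \<open>\<open>G = \<langle>A | R\<rangle>\<close>, where the word \<open>w\<close> represents the element \<open>\<pi> (word_class A R w)\<close> of \<open>G\<close>.\<close>

definition is_presentation ::
  "('g, 'm) monoid_scheme \<Rightarrow> 'a set \<Rightarrow> ('a word \<times> 'a word) set \<Rightarrow> ('a word set \<Rightarrow> 'g) \<Rightarrow> bool" where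
  "is_presentation G A R \<pi> \<longleftrightarrow>
    R \<subseteq> words_over A \<times> words_over A \<and> \<pi> \<in> iso (presented_group A R) G"

lemma word_cong_words:
  assumes "(u, v) \<in> word_cong A R"
  shows "u \<in> words_over A \<and> v \<in> words_over A"
  using assms by induction (auto simp: words_over_def)

lemma equiv_word_cong: "equiv (words_over A) (word_cong A R)"
proof (rule equivI)
  show "word_cong A R \<subseteq> words_over A \<times> words_over A"
    using word_cong_words by fast
  show "refl_on (words_over A) (word_cong A R)"
    by (simp add: refl_on_def word_cong.refl)
  show "Relation.sym (word_cong A R)"
    by (rule symI) (rule word_cong.sym)
  show "Relation.trans (word_cong A R)"
    by (rule transI) (rule word_cong.trans)
qed

lemma word_class_eq_iff:
  assumes "u \<in> words_over A" "v \<in> words_over A"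
  shows "word_class A R u = word_class A R v \<longleftrightarrow> (u, v) \<in> word_cong A R"
  unfolding word_class_def using eq_equiv_class_iff[OF equiv_word_cong assms] .

lemma mult_presented_group:
  assumes "u \<in> words_over A" "v \<in> words_over A"
  shows "word_class A R u \<otimes>\<^bsub>presented_group A R\<^esub> word_class A R v = word_class A R (u @ v)"
proof -
  have "word_class A R (u' @ v') = word_class A R (u @ v)"
    if "u' \<in> word_class A R u" "v' \<in> word_class A R v" for u' v'
  proof -
    have cong: "(u @ v, u' @ v') \<in> word_cong A R"
      using that by (simp add: word_class_def word_cong.append)
    from word_cong_words[OF this] show ?thesis
      using cong by (simp add: word_class_eq_iff word_cong.sym)
  qed
  moreover have "u \<in> word_class A R u" "v \<in> word_class A R v"
    using assms by (simp_all add: word_class_def word_cong.refl)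
  ultimately have "(\<Union>u'\<in>word_class A R u. \<Union>v'\<in>word_class A R v. word_class A R (u' @ v'))
      = word_class A R (u @ v)"
    by blast
  then show ?thesis
    by (simp add: presented_group_def)
qed

lemma carrier_presented_group:
  "carrier (presented_group A R) = word_class A R ` words_over A"
  by (auto simp: presented_group_def quotient_def word_class_def)

lemma word_cong_inverse:
  assumes "w \<in> words_over A"
  shows "(rev (map (\<lambda>(a, b). (a, \<not> b)) w) @ w, []) \<in> word_cong A R"
  using assms
proof (induction w)
  case Nil
  then show ?case by (auto simp: words_over_def intro: word_cong.refl)
next
  case (Cons x w)
  obtain a b where x: "x = (a, b)" by fastforce
  let ?i = "rev (map (\<lambda>(a, b). (a, \<not> b)) w)"
  have a: "a \<in> A" and w: "w \<in> words_over A" and i: "?i \<in> words_over A"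
    using Cons.prems by (auto simp: x words_over_def)
  have "([(a, \<not> b), (a, b)], []) \<in> word_cong A R"
    using word_cong.cancel[OF a, of "\<not> b" R] by simp
  then have "(?i @ [(a, \<not> b), (a, b)] @ w, ?i @ [] @ w) \<in> word_cong A R"
    by (intro word_cong.append word_cong.refl i w)
  then show ?case
    using word_cong.trans[OF _ Cons.IH[OF w]] by (simp add: x)
qed

lemma group_presented_group: "group (presented_group A R)"
proof (rule groupI)
  let ?P = "presented_group A R"
  have one: "\<one>\<^bsub>?P\<^esub> = word_class A R []" by (simp add: presented_group_def)
  have nil: "[] \<in> words_over A" by (simp add: words_over_def)
  have app: "u @ v \<in> words_over A" if "u \<in> words_over A" "v \<in> words_over A" for u v
    using that by (simp add: words_over_def)
  show "x \<otimes>\<^bsub>?P\<^esub> y \<in> carrier ?P" if "x \<in> carrier ?P" "y \<in> carrier ?P" for x y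
    using that by (auto simp: carrier_presented_group mult_presented_group app)
  show "\<one>\<^bsub>?P\<^esub> \<in> carrier ?P" by (simp add: carrier_presented_group one nil)
  show "x \<otimes>\<^bsub>?P\<^esub> y \<otimes>\<^bsub>?P\<^esub> z = x \<otimes>\<^bsub>?P\<^esub> (y \<otimes>\<^bsub>?P\<^esub> z)"
    if "x \<in> carrier ?P" "y \<in> carrier ?P" "z \<in> carrier ?P" for x y z
    using that by (auto simp: carrier_presented_group mult_presented_group app)
  show "\<one>\<^bsub>?P\<^esub> \<otimes>\<^bsub>?P\<^esub> x = x" if "x \<in> carrier ?P" for x
    using that by (auto simp: carrier_presented_group mult_presented_group one nil)
  show "\<exists>y\<in>carrier ?P. y \<otimes>\<^bsub>?P\<^esub> x = \<one>\<^bsub>?P\<^esub>" if "x \<in> carrier ?P" for x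
  proof -
    from that obtain w where w: "w \<in> words_over A" and x: "x = word_class A R w"
      by (auto simp: carrier_presented_group)
    let ?i = "rev (map (\<lambda>(a, b). (a, \<not> b)) w)"
    have i: "?i \<in> words_over A" using w by (auto simp: words_over_def)
    have "word_class A R ?i \<otimes>\<^bsub>?P\<^esub> x = \<one>\<^bsub>?P\<^esub>"
      using word_cong_inverse[OF w] by (simp add: x one mult_presented_group i w
          word_class_eq_iff app nil)
    then show ?thesis using i by (auto simp: carrier_presented_group)
  qed
qed

section \<open>The groups \<open>G \<rtimes>\<^sub>\<phi> \<int>\<close>\<close>

text \<open>
  \<open>\<langle>A, t | R, t\<^sup>-\<^sup>1 a t = a\<phi> (a \<in> A)\<rangle>\<close> for \<open>G = \<langle>A | R\<rangle>\<close>. The stable letter \<open>t\<close> is \<open>None\<close>, and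
  \<open>a \<in> A\<close> becomes \<open>Some a\<close>. The right-hand side \<open>a\<phi>\<close> has to be written as a word over \<open>A\<close>; the
  relation is included for every word representing this element, which makes no difference to the
  group, because any two such words are already equal modulo \<open>R\<close>.
\<close>

definition embed_word :: "'a word \<Rightarrow> 'a option word" where
  "embed_word = map (map_prod Some id)"

definition semidirect_rels ::
  "'a set \<Rightarrow> ('a word \<times> 'a word) set \<Rightarrow> ('a word set \<Rightarrow> 'g) \<Rightarrow> ('g \<Rightarrow> 'g) \<Rightarrow>
    ('a option word \<times> 'a option word) set" where
  "semidirect_rels A R \<pi> \<phi> =
    {(embed_word u, embed_word v) | u v. (u, v) \<in> R} \<union>
    {([(None, False), (Some a, True), (None, True)], embed_word w) | a w.
      a \<in> A \<and> w \<in> words_over A \<and>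
      \<pi> (word_class A R w) = \<phi> (\<pi> (word_class A R [(a, True)]))}"

definition semidirect_int ::
  "'a set \<Rightarrow> ('a word \<times> 'a word) set \<Rightarrow> ('a word set \<Rightarrow> 'g) \<Rightarrow> ('g \<Rightarrow> 'g) \<Rightarrow>
    'a option word set monoid" where
  "semidirect_int A R \<pi> \<phi> = presented_group (insert None (Some ` A)) (semidirect_rels A R \<pi> \<phi>)"

section \<open>The profinite topology and separability\<close>

text \<open>Left and right cosets of finite index subgroups form the same family: \<open>g H = (g H g\<^sup>-\<^sup>1) g\<close>.\<close>

definition finite_index_coset :: "('g, 'm) monoid_scheme \<Rightarrow> 'g set \<Rightarrow> bool" where
  "finite_index_coset G U \<longleftrightarrow>
    (\<exists>H g. subgroup H G \<and> finite (rcosets\<^bsub>G\<^esub> H) \<and> g \<in> carrier G \<and> U = H #>\<^bsub>G\<^esub> g)"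

definition profinite_topology :: "('g, 'm) monoid_scheme \<Rightarrow> 'g topology" where
  "profinite_topology G = topology (arbitrary union_of (finite_index_coset G))"

definition separable :: "('g, 'm) monoid_scheme \<Rightarrow> 'g set \<Rightarrow> bool" where
  "separable G S \<longleftrightarrow> closedin (profinite_topology G) S"

lemma (in group) rcoset_Int:
  assumes "subgroup H G" "subgroup K G" "g \<in> carrier G"
  shows "(H \<inter> K) #> g = (H #> g) \<inter> (K #> g)"
proof -
  have "h = k" if "h \<in> H" "k \<in> K" "h \<otimes> g = k \<otimes> g" for h k
    using that assms by (meson right_cancel subgroup.mem_carrier)
  then show ?thesis unfolding r_coset_def by blast
qed

lemma (in group) finite_index_Int:
  assumes H: "subgroup H G" "finite (rcosets H)" and K: "subgroup K G" "finite (rcosets K)"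
  shows "finite (rcosets (H \<inter> K))"
proof (rule finite_subset)
  show "rcosets (H \<inter> K) \<subseteq> (\<lambda>(X, Y). X \<inter> Y) ` ((rcosets H) \<times> (rcosets K))"
  proof
    fix C assume "C \<in> rcosets (H \<inter> K)"
    then obtain g where "g \<in> carrier G" "C = (H #> g) \<inter> (K #> g)"
      using rcoset_Int[OF H(1) K(1)] by (auto simp: RCOSETS_def)
    then show "C \<in> (\<lambda>(X, Y). X \<inter> Y) ` ((rcosets H) \<times> (rcosets K))"
      by (intro image_eqI[where x = "(H #> g, K #> g)"]) (auto simp: RCOSETS_def)
  qed
  show "finite ((\<lambda>(X, Y). X \<inter> Y) ` ((rcosets H) \<times> (rcosets K)))"
    using H K by simp
qed

text \<open>So the cosets of finite index subgroups are indeed the basis of a topology on the carrier.\<close>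

lemma (in group) openin_profinite_topology:
  "openin (profinite_topology G) = arbitrary union_of (finite_index_coset G)"
proof -
  have "(arbitrary union_of (finite_index_coset G)) (U \<inter> V)"
    if "finite_index_coset G U" "finite_index_coset G V" for U V
  proof (cases "U \<inter> V = {}")
    case False
    from that obtain H g K h where
      U: "subgroup H G" "finite (rcosets H)" "g \<in> carrier G" "U = H #> g" and
      V: "subgroup K G" "finite (rcosets K)" "h \<in> carrier G" "V = K #> h"
      by (auto simp: finite_index_coset_def)
    from False obtain x where x: "x \<in> H #> g" "x \<in> K #> h" using U V by auto
    have "x \<in> carrier G"
      using x(1) U r_coset_subset_G subgroup.subset by blast
    moreover have "U = H #> x" "V = K #> x"
      using U V x repr_independence by metis+
    ultimately have "finite_index_coset G (U \<inter> V)"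
      unfolding finite_index_coset_def
      using U V rcoset_Int finite_index_Int subgroups_Inter_pair by metis
    then show ?thesis by (rule arbitrary_union_of_inc)
  qed simp
  then have "istopology (arbitrary union_of (finite_index_coset G))"
    by (simp add: istopology_base_eq)
  then show ?thesis
    unfolding profinite_topology_def by (simp add: topology_inverse')
qed

lemma (in group) topspace_profinite_topology: "topspace (profinite_topology G) = carrier G"
proof (rule antisym)
  show "topspace (profinite_topology G) \<subseteq> carrier G"
    unfolding topspace_def openin_profinite_topology union_of_def finite_index_coset_def
    using r_coset_subset_G subgroup.subset by blast
  have "rcosets (carrier G) \<subseteq> {carrier G}"
    using coset_join2[OF _ subgroup_self] by (auto simp: RCOSETS_def)
  then have "finite_index_coset G (carrier G)"
    unfolding finite_index_coset_def
    using subgroup_self coset_mult_one[of "carrier G"] finite_subset by blast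
  then show "carrier G \<subseteq> topspace (profinite_topology G)"
    by (simp add: openin_profinite_topology arbitrary_union_of_inc openin_subset)
qed

definition conjugacy_separable :: "('g, 'm) monoid_scheme \<Rightarrow> bool" where
  "conjugacy_separable G \<longleftrightarrow>
    (\<forall>x\<in>carrier G. separable G {inv\<^bsub>G\<^esub> z \<otimes>\<^bsub>G\<^esub> x \<otimes>\<^bsub>G\<^esub> z | z. z \<in> carrier G})"

definition twisted_conjugacy_separable :: "('g, 'm) monoid_scheme \<Rightarrow> bool" where
  "twisted_conjugacy_separable G \<longleftrightarrow>
    (\<forall>\<phi>\<in>auto G. \<forall>x\<in>carrier G.
      separable G {\<phi> (inv\<^bsub>G\<^esub> z) \<otimes>\<^bsub>G\<^esub> x \<otimes>\<^bsub>G\<^esub> z | z. z \<in> carrier G})"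

definition Brinkmann_conjugacy_separable :: "('g, 'm) monoid_scheme \<Rightarrow> bool" where
  "Brinkmann_conjugacy_separable G \<longleftrightarrow>
    (\<forall>\<phi>\<in>auto G. \<forall>x\<in>carrier G.
      separable G {inv\<^bsub>G\<^esub> z \<otimes>\<^bsub>G\<^esub> (\<phi> [^]\<^bsub>AutoGroup G\<^esub> k) x \<otimes>\<^bsub>G\<^esub> z | z (k :: int). z \<in> carrier G})"

end

theory Submission
  imports Defs
begin

text \<open>
  Let \<open>S = G \<rtimes>\<^sub>\<phi> \<int>\<close>, with the canonical map \<open>\<iota>\<close> from \<open>G\<close> and the stable letter \<open>t\<close>, so that
  \<open>t\<^sup>-\<^sup>1 \<iota>(g) t = \<iota>(g\<phi>)\<close>. Every element of \<open>S\<close> has the form \<open>t\<^sup>k \<iota>(z)\<close>. Conjugating \<open>\<iota>(x)\<close> by it gives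
  \<open>\<iota>(z\<^sup>-\<^sup>1 (x\<phi>\<^sup>k) z)\<close>, and conjugating \<open>t \<iota>(x)\<close> gives \<open>t \<iota>((z\<^sup>-\<^sup>1\<phi>) (x\<phi>\<^sup>k) z)\<close>. Since \<open>x\<phi>\<close> is always
  \<open>\<phi>\<close>-twisted conjugate to \<open>x\<close> (take \<open>z = x\<^sup>-\<^sup>1\<close>), the exponent \<open>k\<close> does not enlarge the twisted class.
  Hence the Brinkmann class of \<open>x\<close> is the preimage of the conjugacy class of \<open>\<iota>(x)\<close> under \<open>\<iota>\<close>
  (\<open>Brinkmann_class_eq\<close>), and the twisted conjugacy class of \<open>x\<close> is the preimage of the conjugacy class
  of \<open>t \<iota>(x)\<close> under \<open>y \<mapsto> t \<iota>(y)\<close> (\<open>twisted_class_eq\<close>). Homomorphisms and translations are continuous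
  for the profinite topologies, so preimages of separable sets under \<open>y \<mapsto> c h(y)\<close> are separable
  (\<open>separable_vimage\<close>), and both claims follow.

  The group \<open>S\<close> is given only by a presentation, and the argument needs to read off \<open>k\<close> and \<open>z\<close> from an
  element of \<open>S\<close> and to know that \<open>\<iota>\<close> is injective. Both are supplied by a homomorphism \<open>\<Psi>\<close> to the
  semidirect product built on \<open>\<int> \<times> G\<close>, which sends \<open>\<iota>(g)\<close> to \<open>(0, g)\<close> and \<open>t\<close> to \<open>(1, 1)\<close>: an equation
  in \<open>S\<close> is mapped to an equation between pairs, whose second components give the relation in \<open>G\<close>.
  The maps \<open>\<iota>\<close> and \<open>\<Psi>\<close>
  come from the universal property of presentations (\<open>von_Dyck\<close>).
\<close>

section \<open>The universal property of a presentation\<close>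

definition word_value :: "('h, 'n) monoid_scheme \<Rightarrow> ('a \<Rightarrow> 'h) \<Rightarrow> 'a word \<Rightarrow> 'h" where
  "word_value H f = (\<lambda>w. foldr (\<lambda>(a, b) h. (if b then f a else inv\<^bsub>H\<^esub> f a) \<otimes>\<^bsub>H\<^esub> h) w \<one>\<^bsub>H\<^esub>)"

lemma word_value_simps [simp]:
  "word_value H f [] = \<one>\<^bsub>H\<^esub>"
  "word_value H f ((a, b) # w) = (if b then f a else inv\<^bsub>H\<^esub> f a) \<otimes>\<^bsub>H\<^esub> word_value H f w"
  by (simp_all add: word_value_def)

lemma words_over_simps [simp]:
  "[] \<in> words_over A"
  "(a, b) # w \<in> words_over A \<longleftrightarrow> a \<in> A \<and> w \<in> words_over A"
  "u @ v \<in> words_over A \<longleftrightarrow> u \<in> words_over A \<and> v \<in> words_over A"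
  by (auto simp: words_over_def)

lemma word_value_embed_word:
  "word_value H f (embed_word w) = word_value H (\<lambda>a. f (Some a)) w"
  by (induction w) (auto simp: embed_word_def)

lemma embed_word_words:
  "w \<in> words_over A \<Longrightarrow> embed_word w \<in> words_over (insert None (Some ` A))"
  by (induction w) (auto simp: embed_word_def)

lemma (in group) word_value_closed:
  assumes "f \<in> A \<rightarrow> carrier G" "w \<in> words_over A"
  shows "word_value G f w \<in> carrier G"
  using assms(2)
proof (induction w)
  case (Cons x w)
  then show ?case using assms(1) by (cases x) (auto simp: Pi_iff)
qed simp

lemma (in group) word_value_append:
  assumes f: "f \<in> A \<rightarrow> carrier G" and u: "u \<in> words_over A" and v: "v \<in> words_over A"
  shows "word_value G f (u @ v) = word_value G f u \<otimes> word_value G f v"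
  using u
proof (induction u)
  case (Cons x u)
  then show ?case
    using word_value_closed[OF f] v f by (cases x) (auto simp: Pi_iff m_assoc)
qed (simp add: word_value_closed[OF f v])

lemma (in group) word_value_cong:
  assumes f: "f \<in> A \<rightarrow> carrier G"
    and R: "\<And>u v. (u, v) \<in> R \<Longrightarrow> u \<in> words_over A \<Longrightarrow> v \<in> words_over A \<Longrightarrow>
      word_value G f u = word_value G f v"
    and uv: "(u, v) \<in> word_cong A R"
  shows "word_value G f u = word_value G f v"
  using uv
proof induction
  case (append u v u' v')
  then show ?case
    using word_cong_words word_value_append[OF f] by metis
next
  case (cancel a b)
  then show ?case using f by (auto simp: Pi_iff)
next
  case (relation u v)
  then show ?case by (rule R)
qed simp_all

text \<open>
  The evaluation of words is constant on the classes of \<^const>\<open>word_cong\<close>, so the homomorphism takes a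
  class to the single value that its words have.
\<close>

lemma (in group) von_Dyck:
  assumes f: "f \<in> A \<rightarrow> carrier G"
    and R: "\<And>u v. (u, v) \<in> R \<Longrightarrow> u \<in> words_over A \<Longrightarrow> v \<in> words_over A \<Longrightarrow>
      word_value G f u = word_value G f v"
  obtains h where "h \<in> hom (presented_group A R) G"
    and "\<And>w. w \<in> words_over A \<Longrightarrow> h (word_class A R w) = word_value G f w"
proof -
  define h where "h X = the_elem (word_value G f ` X)" for X
  have h: "h (word_class A R w) = word_value G f w" if w: "w \<in> words_over A" for w
  proof -
    have "word_value G f ` word_class A R w = {word_value G f w}"
    proof (intro equalityI subsetI)
      fix y assume "y \<in> word_value G f ` word_class A R w"
      then obtain v where v: "(w, v) \<in> word_cong A R" and y: "y = word_value G f v"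
        by (auto simp: word_class_def)
      have "word_value G f w = word_value G f v"
        by (rule word_value_cong[OF f _ v]) (rule R)
      with y show "y \<in> {word_value G f w}" by simp
    next
      have "w \<in> word_class A R w" using w by (simp add: word_class_def word_cong.refl)
      then show "y \<in> word_value G f ` word_class A R w" if "y \<in> {word_value G f w}" for y
        using that by simp
    qed
    then show ?thesis by (simp add: h_def)
  qed
  moreover have "h \<in> hom (presented_group A R) G"
    by (rule homI) (auto simp: carrier_presented_group mult_presented_group h
        word_value_closed[OF f] word_value_append[OF f])
  ultimately show thesis using that by blast
qed

text \<open>
  The uniqueness half of the universal property. In this form it also computes the value of a
  homomorphism at a class, which is used below to evaluate words of the shape \<^term>\<open>embed_word w\<close>.
\<close>

lemma hom_presented_group_eq_word_value:
  assumes "group H" and h: "h \<in> hom (presented_group A R) H" and "w \<in> words_over A"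
  shows "h (word_class A R w) = word_value H (\<lambda>a. h (word_class A R [(a, True)])) w"
proof -
  let ?P = "presented_group A R"
  interpret P: group ?P by (rule group_presented_group)
  interpret H: group H by fact
  interpret h: group_hom ?P H h by unfold_locales (rule h)
  have one: "\<one>\<^bsub>?P\<^esub> = word_class A R []" by (simp add: presented_group_def)
  have carrier: "word_class A R w \<in> carrier ?P" if "w \<in> words_over A" for w
    using that by (simp add: carrier_presented_group)
  show ?thesis
    using assms(3)
  proof (induction w)
    case Nil
    then show ?case using h.hom_one by (simp add: one)
  next
    case (Cons x w)
    obtain a b where x: "x = (a, b)" by fastforce
    have a: "a \<in> A" and w: "w \<in> words_over A" using Cons.prems by (auto simp: x)
    have "word_class A R [(a, False)] \<otimes>\<^bsub>?P\<^esub> word_class A R [(a, True)] = \<one>\<^bsub>?P\<^esub>"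
      using word_cong.cancel[OF a, of False R] a
      by (simp add: mult_presented_group one word_class_eq_iff)
    then have "inv\<^bsub>?P\<^esub> word_class A R [(a, True)] = word_class A R [(a, False)]"
      using a by (intro P.inv_equality carrier) auto
    then have "h (word_class A R [x]) =
        (if b then h (word_class A R [(a, True)]) else inv\<^bsub>H\<^esub> h (word_class A R [(a, True)]))"
      using h.hom_inv[OF carrier, of "[(a, True)]"] a by (cases b) (auto simp: x)
    moreover have "word_class A R (x # w) = word_class A R [x] \<otimes>\<^bsub>?P\<^esub> word_class A R w"
      using mult_presented_group[of "[x]" A w R] a w by (simp add: x)
    ultimately show ?case
      using h.hom_mult[OF carrier carrier, of "[x]" w] Cons.IH[OF w] a w by (simp add: x)
  qed
qed

corollary hom_presented_group_eqI:
  assumes "group H" "h \<in> hom (presented_group A R) H" "k \<in> hom (presented_group A R) H"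
    and "\<And>a. a \<in> A \<Longrightarrow> h (word_class A R [(a, True)]) = k (word_class A R [(a, True)])"
    and "X \<in> carrier (presented_group A R)"
  shows "h X = k X"
proof -
  obtain w where w: "w \<in> words_over A" and X: "X = word_class A R w"
    using assms(5) by (auto simp: carrier_presented_group)
  have "word_value H (\<lambda>a. h (word_class A R [(a, True)])) w =
      word_value H (\<lambda>a. k (word_class A R [(a, True)])) w"
    using w
  proof (induction w)
    case (Cons x w)
    then show ?case using assms(4) by (cases x) auto
  qed simp
  then show ?thesis
    using hom_presented_group_eq_word_value[OF assms(1,2) w]
      hom_presented_group_eq_word_value[OF assms(1,3) w] X by simp
qed

section \<open>The semidirect product on pairs\<close>

lemma (in group) auto_int_pow:
  fixes k l :: int
  assumes \<phi>: "\<phi> \<in> auto G"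
  shows "\<phi> [^]\<^bsub>AutoGroup G\<^esub> k \<in> auto G"
    and "x \<in> carrier G \<Longrightarrow> \<one>\<^bsub>AutoGroup G\<^esub> x = x"
    and "x \<in> carrier G \<Longrightarrow> (\<phi> [^]\<^bsub>AutoGroup G\<^esub> (1 :: int)) x = \<phi> x"
    and "x \<in> carrier G \<Longrightarrow> (\<phi> [^]\<^bsub>AutoGroup G\<^esub> (k + l)) x =
      (\<phi> [^]\<^bsub>AutoGroup G\<^esub> k) ((\<phi> [^]\<^bsub>AutoGroup G\<^esub> l) x)"
proof -
  interpret Aut: group "AutoGroup G" by (rule AutoGroup)
  have carrier: "carrier (AutoGroup G) = auto G" by (simp add: AutoGroup_def)
  have mult: "\<alpha> \<otimes>\<^bsub>AutoGroup G\<^esub> \<beta> = compose (carrier G) \<alpha> \<beta>" if "\<alpha> \<in> auto G" "\<beta> \<in> auto G" for \<alpha> \<beta>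
    using that by (auto simp: AutoGroup_def BijGroup_def auto_def)
  show pow: "\<phi> [^]\<^bsub>AutoGroup G\<^esub> k \<in> auto G" for k :: int
    using Aut.int_pow_closed[of \<phi> k] \<phi> by (simp add: carrier)
  show "x \<in> carrier G \<Longrightarrow> \<one>\<^bsub>AutoGroup G\<^esub> x = x"
    by (simp add: AutoGroup_def BijGroup_def)
  show "x \<in> carrier G \<Longrightarrow> (\<phi> [^]\<^bsub>AutoGroup G\<^esub> (1 :: int)) x = \<phi> x"
    using \<phi> by (simp add: carrier Aut.int_pow_1)
  show "x \<in> carrier G \<Longrightarrow> (\<phi> [^]\<^bsub>AutoGroup G\<^esub> (k + l)) x =
      (\<phi> [^]\<^bsub>AutoGroup G\<^esub> k) ((\<phi> [^]\<^bsub>AutoGroup G\<^esub> l) x)"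
    using Aut.int_pow_mult[of \<phi> k l] \<phi> by (simp add: carrier mult[OF pow pow] compose_eq)
qed

lemma (in group) auto_group_hom: "\<phi> \<in> auto G \<Longrightarrow> group_hom G G \<phi>"
  by unfold_locales (simp add: auto_def)

text \<open>
  Invariance under one step of \<open>\<phi>\<close> spreads along the whole \<open>\<phi>\<close>-orbit by induction on the integer
  exponent. It takes the place of explicit formulas for \<open>t\<^sup>-\<^sup>k \<iota>(x) t\<^sup>k\<close> and for the element that
  twisted conjugates \<open>x\<close> to \<open>x\<phi>\<^sup>k\<close>.
\<close>

lemma (in group) auto_int_pow_invariant:
  assumes \<phi>: "\<phi> \<in> auto G" and x: "x \<in> carrier G"
    and Q: "\<And>y. y \<in> carrier G \<Longrightarrow> Q (\<phi> y) \<longleftrightarrow> Q y"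
  shows "Q ((\<phi> [^]\<^bsub>AutoGroup G\<^esub> (k :: int)) x) \<longleftrightarrow> Q x"
proof -
  let ?pow = "\<lambda>k :: int. (\<phi> [^]\<^bsub>AutoGroup G\<^esub> k) x"
  have pow: "?pow k \<in> carrier G" for k
    using group_hom.hom_closed[OF auto_group_hom[OF auto_int_pow(1)[OF \<phi>]] x] .
  have step: "Q (?pow (k + 1)) \<longleftrightarrow> Q (?pow k)" for k
    using auto_int_pow(4)[OF \<phi> x, of 1 k] auto_int_pow(3)[OF \<phi> pow] Q[OF pow]
    by (simp add: add.commute)
  show ?thesis
  proof (induction k rule: int_induct[where k = 0])
    case base
    then show ?case by (simp add: auto_int_pow(2)[OF \<phi> x])
  next
    case (step1 k)
    then show ?case using step by blast
  next
    case (step2 k)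
    then show ?case using step[of "k - 1"] by simp
  qed
qed

text \<open>
  The pair \<open>(k, z)\<close> stands for \<open>t\<^sup>k z\<close>; the product is dictated by \<open>z t\<^sup>l = t\<^sup>l (z\<phi>\<^sup>l)\<close>.
\<close>

definition int_extension :: "('g, 'm) monoid_scheme \<Rightarrow> ('g \<Rightarrow> 'g) \<Rightarrow> (int \<times> 'g) monoid" where
  "int_extension G \<phi> =
    \<lparr>carrier = UNIV \<times> carrier G,
     mult = (\<lambda>(k, z) (l, w). (k + l, (\<phi> [^]\<^bsub>AutoGroup G\<^esub> l) z \<otimes>\<^bsub>G\<^esub> w)),
     one = (0, \<one>\<^bsub>G\<^esub>)\<rparr>"

lemma int_extension_simps [simp]:
  "carrier (int_extension G \<phi>) = UNIV \<times> carrier G"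
  "(k, z) \<otimes>\<^bsub>int_extension G \<phi>\<^esub> (l, w) = (k + l, (\<phi> [^]\<^bsub>AutoGroup G\<^esub> l) z \<otimes>\<^bsub>G\<^esub> w)"
  "\<one>\<^bsub>int_extension G \<phi>\<^esub> = (0, \<one>\<^bsub>G\<^esub>)"
  by (simp_all add: int_extension_def)

lemma (in group) group_int_extension:
  assumes \<phi>: "\<phi> \<in> auto G"
  shows "group (int_extension G \<phi>)"
proof (rule groupI)
  let ?E = "int_extension G \<phi>"
  note hom = auto_group_hom[OF auto_int_pow(1)[OF \<phi>]]
  note hom_simps [simp] = group_hom.hom_closed[OF hom] group_hom.hom_mult[OF hom]
    group_hom.hom_one[OF hom]
  show "X \<otimes>\<^bsub>?E\<^esub> Y \<in> carrier ?E" if "X \<in> carrier ?E" "Y \<in> carrier ?E" for X Y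
    using that by (cases X; cases Y) simp
  show "\<one>\<^bsub>?E\<^esub> \<in> carrier ?E" by simp
  show "X \<otimes>\<^bsub>?E\<^esub> Y \<otimes>\<^bsub>?E\<^esub> Z = X \<otimes>\<^bsub>?E\<^esub> (Y \<otimes>\<^bsub>?E\<^esub> Z)"
    if "X \<in> carrier ?E" "Y \<in> carrier ?E" "Z \<in> carrier ?E" for X Y Z
  proof -
    obtain k x l y m z where "X = (k, x)" "Y = (l, y)" "Z = (m, z)"
      by (meson surj_pair)
    then show ?thesis
      using that auto_int_pow(4)[OF \<phi>, of x m l]
      by (simp add: m_assoc add.commute[of l m])
  qed
  show "\<one>\<^bsub>?E\<^esub> \<otimes>\<^bsub>?E\<^esub> X = X" if "X \<in> carrier ?E" for X
    using that by (cases X) simp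
  show "\<exists>Y\<in>carrier ?E. Y \<otimes>\<^bsub>?E\<^esub> X = \<one>\<^bsub>?E\<^esub>" if "X \<in> carrier ?E" for X
  proof -
    obtain k x where X: "X = (k, x)" by (cases X)
    then have x: "x \<in> carrier G" using that by simp
    have "(\<phi> [^]\<^bsub>AutoGroup G\<^esub> k) ((\<phi> [^]\<^bsub>AutoGroup G\<^esub> (- k)) (inv x)) = inv x"
      using auto_int_pow(4)[OF \<phi>, of "inv x" k "- k"] auto_int_pow(2)[OF \<phi>, of "inv x"] x by simp
    then show ?thesis
      using x by (intro bexI[where x = "(- k, (\<phi> [^]\<^bsub>AutoGroup G\<^esub> (- k)) (inv x))"]) (auto simp: X)
  qed
qed

section \<open>The stable letter\<close>

text \<open>
  The part of the structure of \<open>G \<rtimes>\<^sub>\<phi> \<int>\<close> on which the comparison of conjugacy classes rests: \<open>\<iota>\<close> and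
  \<open>t\<close> produce conjugations in \<open>S\<close>, and \<open>\<Psi>\<close> detects them in \<open>G\<close>.
\<close>

locale stable_letter_extension = G: group G + S: group S
  for G :: "('g, 'm) monoid_scheme" and S :: "('s, 'n) monoid_scheme" +
  fixes \<phi> :: "'g \<Rightarrow> 'g" and \<iota> :: "'g \<Rightarrow> 's" and t :: 's and \<Psi> :: "'s \<Rightarrow> int \<times> 'g"
  assumes \<phi>: "\<phi> \<in> auto G"
    and \<iota>_hom: "\<iota> \<in> hom G S"
    and t_closed [simp]: "t \<in> carrier S"
    and t_conj: "g \<in> carrier G \<Longrightarrow> inv\<^bsub>S\<^esub> t \<otimes>\<^bsub>S\<^esub> \<iota> g \<otimes>\<^bsub>S\<^esub> t = \<iota> (\<phi> g)"
    and \<Psi>_hom: "\<Psi> \<in> hom S (int_extension G \<phi>)"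
    and \<Psi>_\<iota>: "g \<in> carrier G \<Longrightarrow> \<Psi> (\<iota> g) = (0, g)"
    and \<Psi>_t: "\<Psi> t = (1, \<one>\<^bsub>G\<^esub>)"

text \<open>
  Since \<open>\<iota>\<close> sends the element represented by \<open>w\<close> to the class of the same word over the larger alphabet,
  the relations from \<open>R\<close> make it well defined and those involving \<open>t\<close> give the conjugation rule on
  generators. Sending \<open>t\<close> to \<open>(1, 1)\<close> and a generator \<open>a\<close> to \<open>(0, a)\<close> respects both kinds of relations,
  which gives \<open>\<Psi>\<close>.
\<close>

lemma semidirect_int_stable_letter_extension:
  assumes "group G" and pres: "is_presentation G A R \<pi>" and \<phi>: "\<phi> \<in> auto G"
  obtains \<iota> t \<Psi> where "stable_letter_extension G (semidirect_int A R \<pi> \<phi>) \<phi> \<iota> t \<Psi>"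
proof -
  interpret G: group G by fact
  interpret \<phi>: group_hom G G \<phi> using \<phi> by (rule G.auto_group_hom)
  let ?B = "insert None (Some ` A)"
  let ?Q = "semidirect_rels A R \<pi> \<phi>"
  let ?P = "presented_group A R"
  let ?S = "presented_group ?B ?Q"
  let ?E = "int_extension G \<phi>"
  interpret P: group ?P by (rule group_presented_group)
  interpret S: group ?S by (rule group_presented_group)
  interpret E: group ?E using \<phi> by (rule G.group_int_extension)
  have \<pi>: "\<pi> \<in> iso ?P G" and R: "R \<subseteq> words_over A \<times> words_over A"
    using pres by (auto simp: is_presentation_def)
  interpret \<pi>: group_hom ?P G \<pi>
    using \<pi> by unfold_locales (simp add: iso_def)
  \<comment> \<open>The identity is a homomorphism from \<open>S\<close> to \<open>S\<close>, so a word evaluates in \<open>S\<close> to its own class.\<close>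
  have embed_value: "word_value ?S (\<lambda>a. word_class ?B ?Q [(Some a, True)]) w =
      word_class ?B ?Q (embed_word w)" if "w \<in> words_over A" for w
    using hom_presented_group_eq_word_value[OF S.is_group _ embed_word_words[OF that],
        where h = "\<lambda>X. X"]
    by (simp add: word_value_embed_word hom_def)
  obtain \<kappa> where \<kappa>: "\<kappa> \<in> hom ?P ?S"
    and \<kappa>_class: "\<And>w. w \<in> words_over A \<Longrightarrow> \<kappa> (word_class A R w) = word_class ?B ?Q (embed_word w)"
  proof -
    have "(\<lambda>a. word_class ?B ?Q [(Some a, True)]) \<in> A \<rightarrow> carrier ?S"
      by (auto simp: carrier_presented_group)
    moreover have "word_value ?S (\<lambda>a. word_class ?B ?Q [(Some a, True)]) u =
        word_value ?S (\<lambda>a. word_class ?B ?Q [(Some a, True)]) v"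
      if "(u, v) \<in> R" "u \<in> words_over A" "v \<in> words_over A" for u v
    proof -
      have "(embed_word u, embed_word v) \<in> ?Q"
        using that by (auto simp: semidirect_rels_def)
      then have "(embed_word u, embed_word v) \<in> word_cong ?B ?Q"
        using that by (intro word_cong.relation embed_word_words)
      then show ?thesis
        using that by (simp add: embed_value word_class_eq_iff[OF embed_word_words embed_word_words])
    qed
    ultimately show thesis
      using S.von_Dyck[of _ A R] that embed_value by (metis (no_types, lifting))
  qed
  define \<pi>' where "\<pi>' = inv_into (carrier ?P) \<pi>"
  have \<pi>': "\<pi>' \<in> hom G ?P"
    using P.iso_set_sym[OF \<pi>] by (simp add: \<pi>'_def iso_def)
  have \<pi>'_\<pi>: "\<pi>' (\<pi> X) = X" if "X \<in> carrier ?P" for X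
    using \<pi> that by (simp add: \<pi>'_def iso_def bij_betw_def)
  have surj: "\<exists>w\<in>words_over A. g = \<pi> (word_class A R w)" if "g \<in> carrier G" for g
    using \<pi> that by (auto simp: iso_def bij_betw_def carrier_presented_group)
  define \<iota> where "\<iota> = \<kappa> \<circ> \<pi>'"
  have \<iota>_hom: "\<iota> \<in> hom G ?S" unfolding \<iota>_def by (rule hom_compose[OF \<pi>' \<kappa>])
  have \<iota>_\<pi>: "\<iota> (\<pi> (word_class A R w)) = word_class ?B ?Q (embed_word w)" if "w \<in> words_over A" for w
    using that by (simp add: \<iota>_def \<pi>'_\<pi> \<kappa>_class carrier_presented_group)
  define t where "t = word_class ?B ?Q [(None, True)]"
  have t: "t \<in> carrier ?S" by (simp add: t_def carrier_presented_group)
  have t_inv: "inv\<^bsub>?S\<^esub> t = word_class ?B ?Q [(None, False)]"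
  proof (rule S.inv_equality)
    show "word_class ?B ?Q [(None, False)] \<otimes>\<^bsub>?S\<^esub> t = \<one>\<^bsub>?S\<^esub>"
      using word_cong.cancel[of None ?B False ?Q]
      by (simp add: t_def mult_presented_group word_class_eq_iff)
        (simp add: presented_group_def word_class_eq_iff)
  qed (auto simp: t_def carrier_presented_group)
  \<comment> \<open>Both sides are homomorphisms in \<open>g\<close>, and the relations make them agree on generators.\<close>
  have conj: "inv\<^bsub>?S\<^esub> t \<otimes>\<^bsub>?S\<^esub> \<iota> g \<otimes>\<^bsub>?S\<^esub> t = \<iota> (\<phi> g)" if g: "g \<in> carrier G" for g
  proof -
    have \<iota>_closed: "\<iota> g \<in> carrier ?S" if "g \<in> carrier G" for g
      using \<iota>_hom that by (auto simp: hom_def)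
    have "(\<lambda>g. inv\<^bsub>?S\<^esub> t \<otimes>\<^bsub>?S\<^esub> \<iota> g \<otimes>\<^bsub>?S\<^esub> t) \<in> hom G ?S"
    proof (rule homI)
      fix g h assume gh: "g \<in> carrier G" "h \<in> carrier G"
      have "t \<otimes>\<^bsub>?S\<^esub> (inv\<^bsub>?S\<^esub> t \<otimes>\<^bsub>?S\<^esub> s) = s" if "s \<in> carrier ?S" for s
        using t that S.m_assoc[of t "inv\<^bsub>?S\<^esub> t" s] by simp
      then show "inv\<^bsub>?S\<^esub> t \<otimes>\<^bsub>?S\<^esub> \<iota> (g \<otimes>\<^bsub>G\<^esub> h) \<otimes>\<^bsub>?S\<^esub> t =
          (inv\<^bsub>?S\<^esub> t \<otimes>\<^bsub>?S\<^esub> \<iota> g \<otimes>\<^bsub>?S\<^esub> t) \<otimes>\<^bsub>?S\<^esub> (inv\<^bsub>?S\<^esub> t \<otimes>\<^bsub>?S\<^esub> \<iota> h \<otimes>\<^bsub>?S\<^esub> t)"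
        using gh t \<iota>_closed by (simp add: hom_mult[OF \<iota>_hom] S.m_assoc)
    qed (use t \<iota>_closed in auto)
    then have hom: "(\<lambda>g. inv\<^bsub>?S\<^esub> t \<otimes>\<^bsub>?S\<^esub> \<iota> g \<otimes>\<^bsub>?S\<^esub> t) \<circ> \<pi> \<in> hom ?P ?S"
      by (rule hom_compose[OF \<pi>.homh])
    have hom': "\<iota> \<circ> \<phi> \<circ> \<pi> \<in> hom ?P ?S"
      by (rule hom_compose[OF \<pi>.homh hom_compose[OF \<phi>.homh \<iota>_hom]])
    have gen: "((\<lambda>g. inv\<^bsub>?S\<^esub> t \<otimes>\<^bsub>?S\<^esub> \<iota> g \<otimes>\<^bsub>?S\<^esub> t) \<circ> \<pi>) (word_class A R [(a, True)]) =
        (\<iota> \<circ> \<phi> \<circ> \<pi>) (word_class A R [(a, True)])" if a: "a \<in> A" for a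
    proof -
      obtain w where w: "w \<in> words_over A"
        and eq: "\<phi> (\<pi> (word_class A R [(a, True)])) = \<pi> (word_class A R w)"
        using surj[of "\<phi> (\<pi> (word_class A R [(a, True)]))"] a
        by (auto simp: carrier_presented_group)
      have "([(None, False), (Some a, True), (None, True)], embed_word w) \<in> ?Q"
        using a w eq by (auto simp: semidirect_rels_def)
      then have "word_class ?B ?Q [(None, False), (Some a, True), (None, True)] =
          word_class ?B ?Q (embed_word w)"
        using a embed_word_words[OF w] by (simp add: word_class_eq_iff word_cong.relation)
      moreover have "\<iota> (\<pi> (word_class A R [(a, True)])) = word_class ?B ?Q [(Some a, True)]"
        using a by (simp add: \<iota>_\<pi> embed_word_def)
      ultimately show ?thesis
        using a w unfolding o_apply t_inv unfolding t_def
        by (simp add: eq \<iota>_\<pi> mult_presented_group)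
    qed
    obtain X where X: "X \<in> carrier ?P" and g_eq: "g = \<pi> X"
      using surj[OF g] by (auto simp: carrier_presented_group)
    show ?thesis
      using hom_presented_group_eqI[OF S.is_group hom hom' gen X] by (simp add: g_eq)
  qed
  define f where "f = case_option (1 :: int, \<one>\<^bsub>G\<^esub>) (\<lambda>a. (0, \<pi> (word_class A R [(a, True)])))"
  \<comment> \<open>On words without \<open>t\<close>, the evaluation agrees with the homomorphism \<open>X \<mapsto> (0, \<pi> X)\<close>.\<close>
  have f_value: "word_value ?E f (embed_word w) = (0, \<pi> (word_class A R w))"
    if "w \<in> words_over A" for w
  proof -
    have "(\<lambda>X. (0, \<pi> X)) \<in> hom ?P ?E"
      by (rule homI) (simp_all add: G.auto_int_pow(2)[OF \<phi>])
    from hom_presented_group_eq_word_value[OF E.is_group this that]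
    show ?thesis by (simp add: word_value_embed_word f_def)
  qed
  have f_closed: "f \<in> ?B \<rightarrow> carrier ?E"
    by (auto simp: f_def carrier_presented_group)
  have f_rels: "word_value ?E f u = word_value ?E f v" if "(u, v) \<in> ?Q" for u v
    using that unfolding semidirect_rels_def
  proof (elim UnE CollectE exE conjE Pair_inject)
    fix u' v' assume "u = embed_word u'" "v = embed_word v'" "(u', v') \<in> R"
    moreover from this have "\<pi> (word_class A R u') = \<pi> (word_class A R v')"
      using R word_cong.relation[of u' v' R A] word_class_eq_iff[of u' A v' R] by fastforce
    ultimately show ?thesis using R f_value by auto
  next
    fix a w assume uv: "u = [(None, False), (Some a, True), (None, True)]" "v = embed_word w"
      and a: "a \<in> A" and w: "w \<in> words_over A"
      and eq: "\<pi> (word_class A R w) = \<phi> (\<pi> (word_class A R [(a, True)]))"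
    let ?x = "\<pi> (word_class A R [(a, True)])"
    have x: "?x \<in> carrier G" using a by (simp add: carrier_presented_group)
    have t_E: "(1, \<one>\<^bsub>G\<^esub>) \<in> carrier ?E" and x_E: "(0, ?x) \<in> carrier ?E"
      and \<phi>x_E: "(0, \<phi> ?x) \<in> carrier ?E"
      using x by simp_all
    have "(0, ?x) \<otimes>\<^bsub>?E\<^esub> (1, \<one>\<^bsub>G\<^esub>) = (1, \<one>\<^bsub>G\<^esub>) \<otimes>\<^bsub>?E\<^esub> (0, \<phi> ?x)"
      using x by (simp add: G.auto_int_pow(2,3)[OF \<phi>])
    then have "inv\<^bsub>?E\<^esub> (1, \<one>\<^bsub>G\<^esub>) \<otimes>\<^bsub>?E\<^esub> ((0, ?x) \<otimes>\<^bsub>?E\<^esub> (1, \<one>\<^bsub>G\<^esub>)) = (0, \<phi> ?x)"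
      using E.inv_solve_left'[OF \<phi>x_E t_E E.m_closed[OF x_E t_E]] by blast
    \<comment> \<open>Products stay folded here, so that the group laws apply to the inverse of \<open>(1, 1)\<close>.\<close>
    moreover have "f None = (1, \<one>\<^bsub>G\<^esub>)" "f (Some a) = (0, ?x)" by (simp_all add: f_def)
    ultimately show ?thesis
      using E.r_one[OF t_E]
      by (simp add: uv f_value[OF w] eq del: int_extension_simps(2,3))
  qed
  obtain \<Psi> where \<Psi>: "\<Psi> \<in> hom ?S ?E"
    and \<Psi>_class: "\<And>w. w \<in> words_over ?B \<Longrightarrow> \<Psi> (word_class ?B ?Q w) = word_value ?E f w"
    using E.von_Dyck[OF f_closed, of ?Q] f_rels by (metis (no_types, lifting))
  have "\<Psi> (\<iota> g) = (0, g)" if "g \<in> carrier G" for g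
  proof -
    obtain w where "w \<in> words_over A" "g = \<pi> (word_class A R w)"
      using surj[OF \<open>g \<in> carrier G\<close>] by blast
    then show ?thesis by (simp add: \<iota>_\<pi> \<Psi>_class f_value embed_word_words)
  qed
  moreover have "\<Psi> t = (1, \<one>\<^bsub>G\<^esub>)"
    using E.r_one[of "(1, \<one>\<^bsub>G\<^esub>)"] by (simp add: t_def \<Psi>_class f_def del: int_extension_simps(2,3))
  ultimately have "stable_letter_extension G ?S \<phi> \<iota> t \<Psi>"
    using \<phi> \<iota>_hom t conj \<Psi> by (intro stable_letter_extension.intro
        stable_letter_extension_axioms.intro G.is_group S.is_group)
  then show thesis using that by (simp add: semidirect_int_def)
qed

section \<open>Conjugacy in the extension\<close>

context stable_letter_extension
begin

sublocale \<iota>: group_hom G S \<iota> by unfold_locales (rule \<iota>_hom)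
sublocale \<phi>: group_hom G G \<phi> by (rule G.auto_group_hom[OF \<phi>])
sublocale E: group "int_extension G \<phi>" by (rule G.group_int_extension[OF \<phi>])
sublocale \<Psi>: group_hom S "int_extension G \<phi>" \<Psi> by unfold_locales (rule \<Psi>_hom)

abbreviation conj_class :: "'s \<Rightarrow> 's set" where
  "conj_class c \<equiv> {inv\<^bsub>S\<^esub> s \<otimes>\<^bsub>S\<^esub> c \<otimes>\<^bsub>S\<^esub> s | s. s \<in> carrier S}"

lemma conj_class_conj:
  assumes c: "c \<in> carrier S" and s: "s \<in> carrier S" and d: "d \<in> carrier S"
  shows "inv\<^bsub>S\<^esub> s \<otimes>\<^bsub>S\<^esub> d \<otimes>\<^bsub>S\<^esub> s \<in> conj_class c \<longleftrightarrow> d \<in> conj_class c"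
proof
  assume "d \<in> conj_class c"
  then obtain r where "r \<in> carrier S" "d = inv\<^bsub>S\<^esub> r \<otimes>\<^bsub>S\<^esub> c \<otimes>\<^bsub>S\<^esub> r" by blast
  then have "inv\<^bsub>S\<^esub> s \<otimes>\<^bsub>S\<^esub> d \<otimes>\<^bsub>S\<^esub> s = inv\<^bsub>S\<^esub> (r \<otimes>\<^bsub>S\<^esub> s) \<otimes>\<^bsub>S\<^esub> c \<otimes>\<^bsub>S\<^esub> (r \<otimes>\<^bsub>S\<^esub> s)"
    using c s by (simp add: S.inv_mult_group S.m_assoc)
  then show "inv\<^bsub>S\<^esub> s \<otimes>\<^bsub>S\<^esub> d \<otimes>\<^bsub>S\<^esub> s \<in> conj_class c"
    using s \<open>r \<in> carrier S\<close> by blast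
next
  assume "inv\<^bsub>S\<^esub> s \<otimes>\<^bsub>S\<^esub> d \<otimes>\<^bsub>S\<^esub> s \<in> conj_class c"
  then obtain r where r: "r \<in> carrier S" "inv\<^bsub>S\<^esub> s \<otimes>\<^bsub>S\<^esub> d \<otimes>\<^bsub>S\<^esub> s = inv\<^bsub>S\<^esub> r \<otimes>\<^bsub>S\<^esub> c \<otimes>\<^bsub>S\<^esub> r" by blast
  have "d = s \<otimes>\<^bsub>S\<^esub> (inv\<^bsub>S\<^esub> s \<otimes>\<^bsub>S\<^esub> d \<otimes>\<^bsub>S\<^esub> s) \<otimes>\<^bsub>S\<^esub> inv\<^bsub>S\<^esub> s"
    using s d by (simp add: S.m_assoc[symmetric]) (simp add: S.m_assoc)
  also have "\<dots> = inv\<^bsub>S\<^esub> (r \<otimes>\<^bsub>S\<^esub> inv\<^bsub>S\<^esub> s) \<otimes>\<^bsub>S\<^esub> c \<otimes>\<^bsub>S\<^esub> (r \<otimes>\<^bsub>S\<^esub> inv\<^bsub>S\<^esub> s)"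
    using c s r by (simp add: S.inv_mult_group S.m_assoc)
  finally show "d \<in> conj_class c"
    using s r(1) by blast
qed

text \<open>
  The class of \<open>\<iota>(x)\<close> is closed under conjugation by \<open>t\<close> and \<open>\<iota>(z)\<close>, hence contains \<open>\<iota>\<close> of the whole
  Brinkmann class. Conversely, if \<open>s \<iota>(y) = \<iota>(x) s\<close> and \<open>\<Psi>(s) = (k, z)\<close>, then applying \<open>\<Psi>\<close> gives
  \<open>z y = (x\<phi>\<^sup>k) z\<close>.
\<close>

lemma Brinkmann_class_eq:
  assumes x: "x \<in> carrier G"
  shows "{inv\<^bsub>G\<^esub> z \<otimes>\<^bsub>G\<^esub> (\<phi> [^]\<^bsub>AutoGroup G\<^esub> k) x \<otimes>\<^bsub>G\<^esub> z | z (k :: int). z \<in> carrier G} =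
    {y \<in> carrier G. \<iota> y \<in> conj_class (\<iota> x)}" (is "?B = ?C")
proof (intro equalityI subsetI)
  have pow: "(\<phi> [^]\<^bsub>AutoGroup G\<^esub> (k :: int)) x \<in> carrier G" for k
    using group_hom.hom_closed[OF G.auto_group_hom[OF G.auto_int_pow(1)[OF \<phi>]] x] .
  fix y assume "y \<in> ?B"
  then obtain z k where z: "z \<in> carrier G"
    and y: "y = inv\<^bsub>G\<^esub> z \<otimes>\<^bsub>G\<^esub> (\<phi> [^]\<^bsub>AutoGroup G\<^esub> (k :: int)) x \<otimes>\<^bsub>G\<^esub> z" by blast
  have "\<iota> (\<phi> g) \<in> conj_class (\<iota> x) \<longleftrightarrow> \<iota> g \<in> conj_class (\<iota> x)" if "g \<in> carrier G" for g
    using conj_class_conj[of "\<iota> x" t "\<iota> g"] x that t_conj by simp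
  then have "\<iota> ((\<phi> [^]\<^bsub>AutoGroup G\<^esub> k) x) \<in> conj_class (\<iota> x) \<longleftrightarrow> \<iota> x \<in> conj_class (\<iota> x)"
    by (rule G.auto_int_pow_invariant[OF \<phi> x])
  moreover have "\<iota> x \<in> conj_class (\<iota> x)"
    using x by (auto intro!: exI[where x = "\<one>\<^bsub>S\<^esub>"])
  ultimately show "y \<in> ?C"
    using z x pow conj_class_conj[of "\<iota> x" "\<iota> z" "\<iota> ((\<phi> [^]\<^bsub>AutoGroup G\<^esub> k) x)"]
    by (simp add: y)
next
  fix y assume "y \<in> ?C"
  then obtain s where y: "y \<in> carrier G" and s: "s \<in> carrier S"
    and ys: "\<iota> y = inv\<^bsub>S\<^esub> s \<otimes>\<^bsub>S\<^esub> \<iota> x \<otimes>\<^bsub>S\<^esub> s" by blast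
  obtain k z where \<Psi>_s: "\<Psi> s = (k, z)" by fastforce
  have z: "z \<in> carrier G" using \<Psi>.hom_closed[OF s] by (simp add: \<Psi>_s)
  have "s \<otimes>\<^bsub>S\<^esub> \<iota> y = \<iota> x \<otimes>\<^bsub>S\<^esub> s"
    using s x y by (simp add: ys S.m_assoc[symmetric])
  then have "\<Psi> (s \<otimes>\<^bsub>S\<^esub> \<iota> y) = \<Psi> (\<iota> x \<otimes>\<^bsub>S\<^esub> s)" by simp
  then have "z \<otimes>\<^bsub>G\<^esub> y = (\<phi> [^]\<^bsub>AutoGroup G\<^esub> k) x \<otimes>\<^bsub>G\<^esub> z"
    using s x y z by (simp add: \<Psi>_\<iota> \<Psi>_s G.auto_int_pow(2)[OF \<phi>])
  moreover have "(\<phi> [^]\<^bsub>AutoGroup G\<^esub> k) x \<in> carrier G"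
    using group_hom.hom_closed[OF G.auto_group_hom[OF G.auto_int_pow(1)[OF \<phi>]] x] .
  ultimately have "y = inv\<^bsub>G\<^esub> z \<otimes>\<^bsub>G\<^esub> (\<phi> [^]\<^bsub>AutoGroup G\<^esub> k) x \<otimes>\<^bsub>G\<^esub> z"
    using y z by (metis G.inv_closed G.inv_solve_left G.m_assoc G.m_closed)
  then show "y \<in> ?B" using z by blast
qed

text \<open>
  The twist comes from moving \<open>\<iota>(z)\<^sup>-\<^sup>1\<close> past \<open>t\<close>. Conversely, if \<open>s t \<iota>(y) = t \<iota>(x) s\<close> and
  \<open>\<Psi>(s) = (k, z)\<close>, then applying \<open>\<Psi>\<close> gives \<open>(z\<phi>) y = (x\<phi>\<^sup>k) z\<close>, so \<open>y\<close> is twisted conjugate to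
  \<open>x\<phi>\<^sup>k\<close>; this element is in turn twisted conjugate to \<open>x\<close>, because every \<open>g\<close> is twisted conjugate to
  \<open>g\<phi>\<close>.
\<close>

lemma twisted_class_eq:
  assumes x: "x \<in> carrier G"
  shows "{\<phi> (inv\<^bsub>G\<^esub> z) \<otimes>\<^bsub>G\<^esub> x \<otimes>\<^bsub>G\<^esub> z | z. z \<in> carrier G} =
    {y \<in> carrier G. t \<otimes>\<^bsub>S\<^esub> \<iota> y \<in> conj_class (t \<otimes>\<^bsub>S\<^esub> \<iota> x)}" (is "?T = ?C")
proof (intro equalityI subsetI)
  fix y assume "y \<in> ?T"
  then obtain z where z: "z \<in> carrier G" and y: "y = \<phi> (inv\<^bsub>G\<^esub> z) \<otimes>\<^bsub>G\<^esub> x \<otimes>\<^bsub>G\<^esub> z" by blast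
  have "t \<otimes>\<^bsub>S\<^esub> \<iota> (\<phi> (inv\<^bsub>G\<^esub> z)) = inv\<^bsub>S\<^esub> (\<iota> z) \<otimes>\<^bsub>S\<^esub> t"
    using z t_conj[of "inv\<^bsub>G\<^esub> z", symmetric] by (simp add: S.m_assoc[symmetric])
  then have "t \<otimes>\<^bsub>S\<^esub> \<iota> y = inv\<^bsub>S\<^esub> (\<iota> z) \<otimes>\<^bsub>S\<^esub> (t \<otimes>\<^bsub>S\<^esub> \<iota> x) \<otimes>\<^bsub>S\<^esub> \<iota> z"
    using x z by (simp add: y S.m_assoc[symmetric])
  moreover have "y \<in> carrier G" using x z by (simp add: y)
  ultimately show "y \<in> ?C" using z \<iota>.hom_closed by blast
next
  fix y assume "y \<in> ?C"
  then obtain s where y: "y \<in> carrier G" and s: "s \<in> carrier S"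
    and ys: "t \<otimes>\<^bsub>S\<^esub> \<iota> y = inv\<^bsub>S\<^esub> s \<otimes>\<^bsub>S\<^esub> (t \<otimes>\<^bsub>S\<^esub> \<iota> x) \<otimes>\<^bsub>S\<^esub> s" by blast
  obtain k z where \<Psi>_s: "\<Psi> s = (k, z)" by fastforce
  have z: "z \<in> carrier G" using \<Psi>.hom_closed[OF s] by (simp add: \<Psi>_s)
  let ?x = "(\<phi> [^]\<^bsub>AutoGroup G\<^esub> k) x"
  have pow: "?x \<in> carrier G"
    using group_hom.hom_closed[OF G.auto_group_hom[OF G.auto_int_pow(1)[OF \<phi>]] x] .
  have pow_one: "(\<phi> [^]\<^bsub>AutoGroup G\<^esub> (l :: int)) \<one>\<^bsub>G\<^esub> = \<one>\<^bsub>G\<^esub>" for l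
    using group_hom.hom_one[OF G.auto_group_hom[OF G.auto_int_pow(1)[OF \<phi>]]] .
  have twist: "\<phi> (inv\<^bsub>G\<^esub> w) \<otimes>\<^bsub>G\<^esub> g \<otimes>\<^bsub>G\<^esub> w \<in> ?T" if "g \<in> ?T" "w \<in> carrier G" for g w
  proof -
    from that(1) obtain v where v: "v \<in> carrier G" "g = \<phi> (inv\<^bsub>G\<^esub> v) \<otimes>\<^bsub>G\<^esub> x \<otimes>\<^bsub>G\<^esub> v" by blast
    then have "\<phi> (inv\<^bsub>G\<^esub> w) \<otimes>\<^bsub>G\<^esub> g \<otimes>\<^bsub>G\<^esub> w =
        \<phi> (inv\<^bsub>G\<^esub> (v \<otimes>\<^bsub>G\<^esub> w)) \<otimes>\<^bsub>G\<^esub> x \<otimes>\<^bsub>G\<^esub> (v \<otimes>\<^bsub>G\<^esub> w)"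
      using that x by (simp add: G.inv_mult_group G.m_assoc)
    then show ?thesis using v that by blast
  qed
  \<comment> \<open>Twisting \<open>g\<close> by \<open>g\<^sup>-\<^sup>1\<close> gives \<open>g\<phi>\<close>, and twisting \<open>g\<phi>\<close> by \<open>g\<close> gives back \<open>g\<close>.\<close>
  have "\<phi> g \<in> ?T \<longleftrightarrow> g \<in> ?T" if g: "g \<in> carrier G" for g
  proof
    assume "g \<in> ?T"
    from twist[OF this G.inv_closed[OF g]] show "\<phi> g \<in> ?T" using g by (simp add: G.m_assoc)
  next
    assume "\<phi> g \<in> ?T"
    from twist[OF this g] show "g \<in> ?T" using g by simp
  qed
  then have "?x \<in> ?T \<longleftrightarrow> x \<in> ?T" by (rule G.auto_int_pow_invariant[OF \<phi> x])
  moreover have "x \<in> ?T" using x by (auto intro!: exI[where x = "\<one>\<^bsub>G\<^esub>"])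
  ultimately have T: "\<phi> (inv\<^bsub>G\<^esub> z) \<otimes>\<^bsub>G\<^esub> ?x \<otimes>\<^bsub>G\<^esub> z \<in> ?T" using twist z by blast
  have "s \<otimes>\<^bsub>S\<^esub> (t \<otimes>\<^bsub>S\<^esub> \<iota> y) = t \<otimes>\<^bsub>S\<^esub> \<iota> x \<otimes>\<^bsub>S\<^esub> s"
    using s x y by (simp add: ys S.m_assoc[symmetric])
  then have "\<Psi> (s \<otimes>\<^bsub>S\<^esub> (t \<otimes>\<^bsub>S\<^esub> \<iota> y)) = \<Psi> (t \<otimes>\<^bsub>S\<^esub> \<iota> x \<otimes>\<^bsub>S\<^esub> s)" by simp
  then have "\<phi> z \<otimes>\<^bsub>G\<^esub> y = ?x \<otimes>\<^bsub>G\<^esub> z"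
    using s x y z by (simp add: \<Psi>_\<iota> \<Psi>_t \<Psi>_s pow_one G.auto_int_pow(2,3)[OF \<phi>])
  then have "y = \<phi> (inv\<^bsub>G\<^esub> z) \<otimes>\<^bsub>G\<^esub> ?x \<otimes>\<^bsub>G\<^esub> z"
    using y z pow G.inv_solve_left[of "y" "\<phi> z" "?x \<otimes>\<^bsub>G\<^esub> z"] by (simp add: G.m_assoc)
  with T show "y \<in> ?T" by simp
qed

end

section \<open>Pulling back separable sets\<close>

text \<open>
  The preimage of a right coset of \<open>H\<close> is empty or a right coset of
  \<open>K = {k. c h(k) c\<^sup>-\<^sup>1 \<in> H}\<close>, because \<open>c h(k y) = (c h(k) c\<^sup>-\<^sup>1) (c h(y))\<close>. In particular every
  coset of \<open>K\<close> is the preimage of some coset of \<open>H\<close>, so the index of \<open>K\<close> is finite as well.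
\<close>

lemma finite_index_coset_vimage:
  assumes "group G" "group S" and h: "h \<in> hom G S" and c: "c \<in> carrier S"
    and U: "finite_index_coset S U" and ne: "{y \<in> carrier G. c \<otimes>\<^bsub>S\<^esub> h y \<in> U} \<noteq> {}"
  shows "finite_index_coset G {y \<in> carrier G. c \<otimes>\<^bsub>S\<^esub> h y \<in> U}"
proof -
  interpret G: group G by fact
  interpret S: group S by fact
  interpret h: group_hom G S h by unfold_locales (rule h)
  obtain H s where H: "subgroup H S" and fin: "finite (rcosets\<^bsub>S\<^esub> H)"
    and s: "s \<in> carrier S" and U_def: "U = H #>\<^bsub>S\<^esub> s"
    using U by (auto simp: finite_index_coset_def)
  interpret H: subgroup H S by fact
  define K where "K = {k \<in> carrier G. c \<otimes>\<^bsub>S\<^esub> h k \<otimes>\<^bsub>S\<^esub> inv\<^bsub>S\<^esub> c \<in> H}"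
  have split: "c \<otimes>\<^bsub>S\<^esub> h (k \<otimes>\<^bsub>G\<^esub> l) \<otimes>\<^bsub>S\<^esub> inv\<^bsub>S\<^esub> c =
      (c \<otimes>\<^bsub>S\<^esub> h k \<otimes>\<^bsub>S\<^esub> inv\<^bsub>S\<^esub> c) \<otimes>\<^bsub>S\<^esub> (c \<otimes>\<^bsub>S\<^esub> h l \<otimes>\<^bsub>S\<^esub> inv\<^bsub>S\<^esub> c)"
    if "k \<in> carrier G" "l \<in> carrier G" for k l
  proof -
    have "inv\<^bsub>S\<^esub> c \<otimes>\<^bsub>S\<^esub> (c \<otimes>\<^bsub>S\<^esub> r) = r" if "r \<in> carrier S" for r
      using c that S.m_assoc[of "inv\<^bsub>S\<^esub> c" c r] by simp
    then show ?thesis using that c by (simp add: S.m_assoc)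
  qed
  have K: "subgroup K G"
  proof (rule G.subgroupI)
    show "K \<noteq> {}" using c by (auto simp: K_def intro!: exI[where x = "\<one>\<^bsub>G\<^esub>"])
    show "inv\<^bsub>G\<^esub> k \<in> K" if k: "k \<in> K" for k
    proof -
      have "inv\<^bsub>S\<^esub> (c \<otimes>\<^bsub>S\<^esub> h k \<otimes>\<^bsub>S\<^esub> inv\<^bsub>S\<^esub> c) = c \<otimes>\<^bsub>S\<^esub> h (inv\<^bsub>G\<^esub> k) \<otimes>\<^bsub>S\<^esub> inv\<^bsub>S\<^esub> c"
        using k c by (simp add: K_def S.inv_mult_group S.m_assoc)
      then show ?thesis using k H.m_inv_closed by (fastforce simp: K_def)
    qed
  qed (auto simp: K_def split simp del: h.hom_mult)
  have coset: "{y' \<in> carrier G. c \<otimes>\<^bsub>S\<^esub> h y' \<in> H #>\<^bsub>S\<^esub> (c \<otimes>\<^bsub>S\<^esub> h y)} = K #>\<^bsub>G\<^esub> y"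
    if y: "y \<in> carrier G" for y
  proof -
    have "c \<otimes>\<^bsub>S\<^esub> h y' \<otimes>\<^bsub>S\<^esub> inv\<^bsub>S\<^esub> (c \<otimes>\<^bsub>S\<^esub> h y) = c \<otimes>\<^bsub>S\<^esub> h (y' \<otimes>\<^bsub>G\<^esub> inv\<^bsub>G\<^esub> y) \<otimes>\<^bsub>S\<^esub> inv\<^bsub>S\<^esub> c"
      if "y' \<in> carrier G" for y'
      using that y c by (simp add: S.inv_mult_group S.m_assoc)
    then have "c \<otimes>\<^bsub>S\<^esub> h y' \<in> H #>\<^bsub>S\<^esub> (c \<otimes>\<^bsub>S\<^esub> h y) \<longleftrightarrow> y' \<in> K #>\<^bsub>G\<^esub> y" if "y' \<in> carrier G" for y'
      using that y c H.rcos_module[OF S.is_group] subgroup.rcos_module[OF K G.is_group]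
      by (simp add: K_def)
    moreover have "K #>\<^bsub>G\<^esub> y \<subseteq> carrier G"
      using y K by (simp add: G.r_coset_subset_G subgroup.subset)
    ultimately show ?thesis by blast
  qed
  have "rcosets\<^bsub>G\<^esub> K \<subseteq> (\<lambda>C. {y \<in> carrier G. c \<otimes>\<^bsub>S\<^esub> h y \<in> C}) ` (rcosets\<^bsub>S\<^esub> H)"
  proof
    fix C assume "C \<in> rcosets\<^bsub>G\<^esub> K"
    then obtain y where y: "y \<in> carrier G" and C: "C = K #>\<^bsub>G\<^esub> y"
      by (auto simp: RCOSETS_def)
    have "H #>\<^bsub>S\<^esub> (c \<otimes>\<^bsub>S\<^esub> h y) \<in> rcosets\<^bsub>S\<^esub> H"
      using y c by (auto simp: RCOSETS_def)
    then show "C \<in> (\<lambda>C. {y \<in> carrier G. c \<otimes>\<^bsub>S\<^esub> h y \<in> C}) ` (rcosets\<^bsub>S\<^esub> H)"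
      unfolding C coset[OF y, symmetric] by (rule imageI)
  qed
  then have fin_K: "finite (rcosets\<^bsub>G\<^esub> K)"
    using fin finite_surj by blast
  obtain y where y: "y \<in> carrier G" "c \<otimes>\<^bsub>S\<^esub> h y \<in> H #>\<^bsub>S\<^esub> s"
    using ne by (auto simp: U_def)
  then have "U = H #>\<^bsub>S\<^esub> (c \<otimes>\<^bsub>S\<^esub> h y)"
    using S.repr_independence[OF y(2) s H] by (simp add: U_def)
  then show ?thesis
    using coset[OF y(1)] K fin_K y(1) by (auto simp: finite_index_coset_def)
qed

text \<open>
  Preimages of basic open sets under \<open>y \<mapsto> c h(y)\<close> are open by \<open>finite_index_coset_vimage\<close>, so this map
  is continuous for the profinite topologies and pulls closed sets back to closed sets.
\<close>

lemma separable_vimage: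
  assumes "group G" "group S" and h: "h \<in> hom G S" and c: "c \<in> carrier S"
    and C: "separable S C"
  shows "separable G {y \<in> carrier G. c \<otimes>\<^bsub>S\<^esub> h y \<in> C}"
proof -
  interpret G: group G by fact
  interpret S: group S by fact
  have "continuous_map (profinite_topology G) (profinite_topology S) (\<lambda>y. c \<otimes>\<^bsub>S\<^esub> h y)"
    unfolding continuous_map G.topspace_profinite_topology S.topspace_profinite_topology
  proof (intro conjI allI impI)
    show "(\<lambda>y. c \<otimes>\<^bsub>S\<^esub> h y) ` carrier G \<subseteq> carrier S"
      using h c by (auto simp: hom_def)
    fix U assume "openin (profinite_topology S) U"
    then obtain \<U> where \<U>: "\<And>V. V \<in> \<U> \<Longrightarrow> finite_index_coset S V" and U: "U = \<Union>\<U>"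
      by (auto simp: S.openin_profinite_topology union_of_def)
    have "openin (profinite_topology G) {y \<in> carrier G. c \<otimes>\<^bsub>S\<^esub> h y \<in> V}" if "V \<in> \<U>" for V
    proof (cases "{y \<in> carrier G. c \<otimes>\<^bsub>S\<^esub> h y \<in> V} = {}")
      case True
      then show ?thesis by (simp only: openin_empty)
    next
      case False
      then show ?thesis
        using finite_index_coset_vimage[OF assms(1-4) \<U>[OF that]]
        by (simp add: G.openin_profinite_topology arbitrary_union_of_inc)
    qed
    then have "openin (profinite_topology G) (\<Union>V\<in>\<U>. {y \<in> carrier G. c \<otimes>\<^bsub>S\<^esub> h y \<in> V})"
      by blast
    moreover have "(\<Union>V\<in>\<U>. {y \<in> carrier G. c \<otimes>\<^bsub>S\<^esub> h y \<in> V}) = {y \<in> carrier G. c \<otimes>\<^bsub>S\<^esub> h y \<in> U}"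
      by (auto simp: U)
    ultimately show "openin (profinite_topology G) {y \<in> carrier G. c \<otimes>\<^bsub>S\<^esub> h y \<in> U}" by simp
  qed
  from closedin_continuous_map_preimage[OF this, of C] C show ?thesis
    by (simp add: separable_def G.topspace_profinite_topology)
qed

section \<open>Twisted and Brinkmann conjugacy separability\<close>

theorem corollary5p3:
  fixes G :: "('g, 'm) monoid_scheme"
    and A :: "'a set" and R :: "('a word \<times> 'a word) set" and \<pi> :: "'a word set \<Rightarrow> 'g"
  assumes "group G"
    and "finite A" and "finite R" and "is_presentation G A R \<pi>"
    and "\<forall>\<phi>\<in>auto G. conjugacy_separable (semidirect_int A R \<pi> \<phi>)"
  shows "twisted_conjugacy_separable G \<and> Brinkmann_conjugacy_separable G"
proof -
  have "separable G {\<phi> (inv\<^bsub>G\<^esub> z) \<otimes>\<^bsub>G\<^esub> x \<otimes>\<^bsub>G\<^esub> z | z. z \<in> carrier G} \<and>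
      separable G {inv\<^bsub>G\<^esub> z \<otimes>\<^bsub>G\<^esub> (\<phi> [^]\<^bsub>AutoGroup G\<^esub> k) x \<otimes>\<^bsub>G\<^esub> z | z (k :: int). z \<in> carrier G}"
    if \<phi>: "\<phi> \<in> auto G" and x: "x \<in> carrier G" for \<phi> x
  proof -
    let ?S = "semidirect_int A R \<pi> \<phi>"
    obtain \<iota> t \<Psi> where "stable_letter_extension G ?S \<phi> \<iota> t \<Psi>"
      using semidirect_int_stable_letter_extension[OF assms(1,4) \<phi>] .
    then interpret stable_letter_extension G ?S \<phi> \<iota> t \<Psi> .
    have sep: "separable ?S (conj_class c)" if "c \<in> carrier ?S" for c
      using assms(5) \<phi> that by (simp add: conjugacy_separable_def)
    note preimage = separable_vimage[OF assms(1) S.is_group \<iota>_hom _ sep]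
    \<comment> \<open>The Brinkmann class is the case \<open>c = 1\<close> of the preimage under \<open>y \<mapsto> c \<iota>(y)\<close>.\<close>
    have "{y \<in> carrier G. \<one>\<^bsub>?S\<^esub> \<otimes>\<^bsub>?S\<^esub> \<iota> y \<in> conj_class (\<iota> x)} =
        {y \<in> carrier G. \<iota> y \<in> conj_class (\<iota> x)}"
      by (intro Collect_cong conj_cong) simp_all
    then show ?thesis
      using preimage[of t "t \<otimes>\<^bsub>?S\<^esub> \<iota> x"] preimage[of "\<one>\<^bsub>?S\<^esub>" "\<iota> x"] x
      by (simp only: twisted_class_eq[OF x] Brinkmann_class_eq[OF x]) simp
  qed
  then show ?thesis
    by (simp add: twisted_conjugacy_separable_def Brinkmann_conjugacy_separable_def)
qed

end
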